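(* Let $b,d,e,y,u,w,q,t_1,t_2$ be nonzero complex numbers, let $r_1,r_2,s_1,s_2$ be nonnegative real numbers, and let $n\ge0$ be an integer. Put $C_0(t_1)=(1-bt_1)(1-dt_1)/t_1$. Assume that no denominator below vanishes. Then $$C_0(t_1)\sum_{k=0}^{n-1}\mathcal D\bigl(et_1q^{2(r_2-r_1)(k-1)},bdet_1q^{2(r_1+r_2)(k-1)+2}\bigr)q^{2r_1(k-1)+1}$$ $$\times\frac{(bq,dq;q^{2r_1})_{k-1}(eq,bdet_1^2q;q^{2r_2})_{k-1}}{(det_1q,bet_1q;q^{2r_2})_k(bdt_1q,q/t_1;q^{2r_1})_k}\,\frac{(yq;q^{2s_1})_k(wq,uq,ywut_2^2q;q^{2s_2})_k}{(wut_2q;q^{3s_2-s_1})_k(yut_2q,ywt_2q,q/t_2;q^{s_1+s_2})_k}$$ $$=\frac{(bq,dq;q^{2r_1})_{n-1}(eq,bdet_1^2q;q^{2r_2})_{n-1}}{(det_1q,bet_1q;q^{2r_2})_{n-1}(bdt_1q,q/t_1;q^{2r_1})_{n-1}}\,\frac{(yq;q^{2s_1})_n(wq,uq,ywut_2^2q;q^{2s_2})_n}{(wut_2q;q^{3s_2-s_1})_n(yut_2q,ywt_2q,q/t_2;q^{s_1+s_2})_n}$$ $$-\frac{(q^{2r_2}-det_1q)(q^{2r_2}-bet_1q)(q^{2r_1}-bdt_1q)(q^{2r_1}-q/t_1)}{(q^{2r_1}-bq)(q^{2r_1}-dq)(q^{2r_2}-eq)(q^{2r_2}-bdet_1^2q)}$$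 $$-\frac1{t_2}\sum_{k=0}^{n-1}\mathcal D\bigl(yt_2q^{(s_1-s_2)k},ut_2q^{(s_2-s_1)k},wt_2q^{(s_2-s_1)k},ywut_2q^{(s_1+3s_2)k+2}\bigr)q^{(s_1+s_2)k+1}$$ $$\times\frac{(yq;q^{2s_1})_k(wq,uq,ywut_2^2q;q^{2s_2})_k}{(wut_2q;q^{3s_2-s_1})_{k+1}(yut_2q,ywt_2q,q/t_2;q^{s_1+s_2})_{k+1}}\,\frac{(bq,dq;q^{2r_1})_k(eq,bdet_1^2q;q^{2r_2})_k}{(det_1q,bet_1q;q^{2r_2})_k(bdt_1q,q/t_1;q^{2r_1})_k}.$$
   Context: $\mathcal D(x_1,\dots,x_m):=\prod_{i=1}^m(1-x_i)$. For a nonzero base $q$ and an integer $m\ge 0$, $(a;q)_m=\prod_{j=0}^{m-1}(1-aq^j)$, $(a;q)_{-1}=1/(1-a/q)$, and $(a_1,\dots,a_l;q)_m=\prod_{i=1}^l(a_i;q)_m$. Real powers are $q^t=\exp(t\log q)$ for a fixed choice of $\log q$. Empty sums are $0$. (The paper calls this a $(2,2)$-type transformation with degree $2m$, $m=\max\{r_1,r_2,s_1,s_2\}$.) *)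

theory Defs
  imports Complex_Main
begin

definition one_minus_prod :: "complex list \<Rightarrow> complex" where
  "one_minus_prod xs = (\<Prod>x\<leftarrow>xs. 1 - x)"

(* Only m \<ge> -1 is meaningful; for m < -1 the value is a dummy. *)
definition qpoch :: "complex \<Rightarrow> complex \<Rightarrow> int \<Rightarrow> complex" where
  "qpoch a q m = (if m = -1 then 1 / (1 - a / q) else (\<Prod>j<nat m. 1 - a * q ^ j))"

definition qpochs :: "complex list \<Rightarrow> complex \<Rightarrow> int \<Rightarrow> complex" where
  "qpochs as q m = (\<Prod>a\<leftarrow>as. qpoch a q m)"

(* The real power q^t for the choice l of log q, that is, for an l with exp l = q. *)
definition qpow :: "complex \<Rightarrow> real \<Rightarrow> complex" where
  "qpow l t = exp (of_real t * l)"

definition C0 :: "complex \<Rightarrow> complex \<Rightarrow> complex \<Rightarrow> complex" where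
  "C0 b d t = (1 - b * t) * (1 - d * t) / t"

end

theory Submission
  imports Defs
begin

text \<open>
  Let \<open>A k\<close> and \<open>B k\<close> be the two quotients of shifted factorials, with \<open>k \<ge> -1\<close> allowed in \<open>A\<close>. The claim
  is summation by parts
  \[\sum_{k<n} (A_k - A_{k-1}) B_k = A_{n-1} B_n - A_{-1} B_0 - \sum_{k<n} (B_{k+1} - B_k) A_k,\]
  because both differences factor completely: over a common denominator, their numerators are
  differences of two products of four linear factors, each of which is again a product.
\<close>

lemma sum_by_parts:
  fixes A :: "int \<Rightarrow> 'a::comm_ring" and B :: "int \<Rightarrow> 'a"
  shows "(\<Sum>k<n. (A (int k) - A (int k - 1)) * B (int k))
       = A (int n - 1) * B (int n) - A (-1) * B 0 - (\<Sum>k<n. (B (int k + 1) - B (int k)) * A (int k))"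
  by (induction n) (auto simp: algebra_simps)

text \<open>The numerator is stepped forward and the inverse of the denominator is stepped back, so
  both quotients lie over \<open>y\<close>. Using \<open>inverse y'\<close> instead of
  \<open>y = y' * p'\<close> keeps the rule valid where \<open>y'\<close> has the default value 0,
  as happens for \<open>(a;q)_-1\<close> in a denominator when \<open>a\<close> equals the
  base.\<close>

lemma quotient_diff:
  fixes x y x' y' :: "'a::field"
  assumes "x = x' * p" "inverse y' = p' / y"
  shows "x / y - x' / y' = x' / y * (p - p')"
  using assms by (simp add: divide_inverse[of x' y'] right_diff_distrib diff_divide_distrib)

lemma qpow_add: "qpow l (s + t) = qpow l s * qpow l t"
  by (simp add: qpow_def exp_add algebra_simps)

lemma qpow_minus: "qpow l (- t) = inverse (qpow l t)"
  by (simp add: qpow_def exp_minus)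

lemma qpow_diff: "qpow l (s - t) = qpow l s / qpow l t"
  by (simp add: qpow_def exp_diff algebra_simps)

lemma qpow_nonzero [simp]: "qpow l t \<noteq> 0"
  by (simp add: qpow_def)

lemma qpow_one [simp]: "qpow l 1 = exp l"
  by (simp add: qpow_def)

lemma qpow_mult_nat: "qpow l (of_nat k * t) = qpow l t ^ k"
  by (simp add: qpow_def exp_of_nat_mult[symmetric] mult.assoc)

lemma qpoch_0 [simp]: "qpoch a q 0 = 1"
  by (simp add: qpoch_def)

lemma qpoch_Suc: "qpoch a q (int k + 1) = qpoch a q (int k) * (1 - a * q ^ k)"
  by (simp add: qpoch_def nat_add_distrib)

lemma qpoch_qpow_Suc:
  "qpoch a (qpow l t) (int k + 1) = qpoch a (qpow l t) (int k) * (1 - a * qpow l (t * real k))"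
  by (simp add: qpoch_Suc mult.commute[of t] qpow_mult_nat)

text \<open>Only the step from index -1 is delicate: at \<open>k = 0\<close> the right side is
  \<open>(1 - a/q^t) / (1 - a/q^t)\<close>, which is 1 only if \<open>a\<close> differs from
  \<open>q^t\<close>.\<close>

lemma qpoch_qpow_pred:
  assumes "k > 0 \<or> qpow l t \<noteq> a"
  shows "qpoch a (qpow l t) (int k)
       = qpoch a (qpow l t) (int k - 1) * (1 - a * qpow l (t * (real k - 1)))"
proof (cases k)
  case 0
  have "1 - a / qpow l t \<noteq> 0"
    using assms 0 by (simp add: field_simps)
  with 0 show ?thesis
    by (simp add: qpoch_def qpow_minus divide_inverse)
next
  case (Suc m)
  then show ?thesis
    using qpoch_qpow_Suc[of a l t m] by (simp add: add.commute)
qed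

text \<open>For \<open>k = 0\<close> and \<open>a = q\<^sup>t\<close> the factor \<open>(a;q\<^sup>t)\<^sub>-\<^sub>1\<close> has the junk value 0, and both sides vanish.\<close>

lemma inverse_qpoch_qpow_pred:
  assumes "qpoch a (qpow l t) (int k) \<noteq> 0"
  shows "inverse (qpoch a (qpow l t) (int k - 1))
       = (1 - a * qpow l (t * (real k - 1))) / qpoch a (qpow l t) (int k)"
proof (cases "qpow l t = a \<and> k = 0")
  case True
  then show ?thesis
    by (auto simp: qpoch_def qpow_minus)
next
  case False
  then have "qpoch a (qpow l t) (int k)
      = qpoch a (qpow l t) (int k - 1) * (1 - a * qpow l (t * (real k - 1)))"
    by (intro qpoch_qpow_pred) auto
  with assms show ?thesis
    by (auto simp: divide_inverse)
qed

lemma inverse_qpoch_qpow_Suc: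
  assumes "qpoch a (qpow l t) (int k + 1) \<noteq> 0"
  shows "inverse (qpoch a (qpow l t) (int k))
       = (1 - a * qpow l (t * real k)) / qpoch a (qpow l t) (int k + 1)"
  using assms by (simp add: qpoch_qpow_Suc divide_inverse)

text \<open>The left side vanishes wherever a factor on the right does. If \<open>b*t = 1\<close>,
  \<open>d*t = 1\<close> or \<open>e*t*Y = X\<close>, both products have the same factors in another
  order. If \<open>b*d*e*t*X*Y*q^2 = 1\<close>, the four subtracted terms of one product are the
  inverses of those of the other and multiply to 1. The remaining coefficient is
  \<open>X*q/t\<close>.\<close>

lemma linear_products_diff_fst:
  fixes b d e t q X Y :: complex
  assumes "t \<noteq> 0" "X \<noteq> 0"
  shows "(1 - b*q*X) * (1 - d*q*X) * (1 - e*q*Y) * (1 - b*d*e*t\<^sup>2*q*Y)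
       - (1 - d*e*t*q*Y) * (1 - b*e*t*q*Y) * (1 - b*d*t*q*X) * (1 - q/t*X)
       = C0 b d t * ((1 - e*t*(Y/X)) * (1 - b*d*e*t*(X*Y*q\<^sup>2)) * (X*q))"
  using assms unfolding C0_def
  by (simp add: divide_simps) algebra

text \<open>The same mechanism: \<open>y*t*S = R\<close>, \<open>u*t*R = S\<close> and
  \<open>w*t*R = S\<close> permute the factors, and \<open>y*w*u*t*S*R^3*q^2 = 1\<close> inverts the
  subtracted terms. \<open>S\<close> and \<open>R\<close> stand for \<open>q^(s1*k)\<close> and
  \<open>q^(s2*k)\<close>, without a 2 in the exponent, so that the mixed bases give the monomials
  \<open>S*R\<close> and \<open>R^3/S\<close>.\<close>

lemma linear_products_diff_snd:
  fixes y u w t q S R :: complex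
  assumes "t \<noteq> 0" "S \<noteq> 0" "R \<noteq> 0"
  shows "(1 - y*q*S\<^sup>2) * (1 - w*q*R\<^sup>2) * (1 - u*q*R\<^sup>2) * (1 - y*w*u*t\<^sup>2*q*R\<^sup>2)
       - (1 - w*u*t*q*(R^3/S)) * (1 - y*u*t*q*(S*R)) * (1 - y*w*t*q*(S*R)) * (1 - q/t*(S*R))
       = 1/t * ((1 - y*t*(S/R)) * (1 - u*t*(R/S)) * (1 - w*t*(R/S)) * (1 - y*w*u*t*(S*R^3*q\<^sup>2))
           * (S*R*q))"
  using assms
  by (simp add: divide_simps) algebra

theorem corollary4p6:
  fixes b d e y u w q t1 t2 l :: complex
    and r1 r2 s1 s2 :: real
    and n :: nat
  assumes nonzero: "b \<noteq> 0" "d \<noteq> 0" "e \<noteq> 0" "y \<noteq> 0" "u \<noteq> 0" "w \<noteq> 0" "q \<noteq> 0" "t1 \<noteq> 0" "t2 \<noteq> 0"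
    and nonneg: "r1 \<ge> 0" "r2 \<ge> 0" "s1 \<ge> 0" "s2 \<ge> 0"
    and log_q: "exp l = q"
    and den_sums: "\<And>k. k < n \<Longrightarrow>
          qpochs [d*e*t1*q, b*e*t1*q] (qpow l (2*r2)) (int k)
        * qpochs [b*d*t1*q, q/t1] (qpow l (2*r1)) (int k) \<noteq> 0"
      "\<And>k. k < n \<Longrightarrow>
          qpochs [w*u*t2*q] (qpow l (3*s2 - s1)) (int k)
        * qpochs [y*u*t2*q, y*w*t2*q, q/t2] (qpow l (s1 + s2)) (int k) \<noteq> 0"
    and den_boundary:
      "qpochs [d*e*t1*q, b*e*t1*q] (qpow l (2*r2)) (int n - 1)
        * qpochs [b*d*t1*q, q/t1] (qpow l (2*r1)) (int n - 1) \<noteq> 0"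
      "qpochs [w*u*t2*q] (qpow l (3*s2 - s1)) (int n)
        * qpochs [y*u*t2*q, y*w*t2*q, q/t2] (qpow l (s1 + s2)) (int n) \<noteq> 0"
      "(qpow l (2*r1) - b*q) * (qpow l (2*r1) - d*q)
        * (qpow l (2*r2) - e*q) * (qpow l (2*r2) - b*d*e*t1^2*q) \<noteq> 0"
    and den_right_sum: "\<And>k. k < n \<Longrightarrow>
          qpochs [w*u*t2*q] (qpow l (3*s2 - s1)) (int k + 1)
        * qpochs [y*u*t2*q, y*w*t2*q, q/t2] (qpow l (s1 + s2)) (int k + 1) \<noteq> 0"
  shows
    "C0 b d t1 *
      (\<Sum>k<n.
          one_minus_prod [e*t1 * qpow l (2*(r2 - r1)*(real k - 1)),
                          b*d*e*t1 * qpow l (2*(r1 + r2)*(real k - 1) + 2)]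
        * qpow l (2*r1*(real k - 1) + 1)
        * ((qpochs [b*q, d*q] (qpow l (2*r1)) (int k - 1)
            * qpochs [e*q, b*d*e*t1^2*q] (qpow l (2*r2)) (int k - 1))
          / (qpochs [d*e*t1*q, b*e*t1*q] (qpow l (2*r2)) (int k)
            * qpochs [b*d*t1*q, q/t1] (qpow l (2*r1)) (int k)))
        * ((qpochs [y*q] (qpow l (2*s1)) (int k)
            * qpochs [w*q, u*q, y*w*u*t2^2*q] (qpow l (2*s2)) (int k))
          / (qpochs [w*u*t2*q] (qpow l (3*s2 - s1)) (int k)
            * qpochs [y*u*t2*q, y*w*t2*q, q/t2] (qpow l (s1 + s2)) (int k))))
     = ((qpochs [b*q, d*q] (qpow l (2*r1)) (int n - 1)
            * qpochs [e*q, b*d*e*t1^2*q] (qpow l (2*r2)) (int n - 1))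
          / (qpochs [d*e*t1*q, b*e*t1*q] (qpow l (2*r2)) (int n - 1)
            * qpochs [b*d*t1*q, q/t1] (qpow l (2*r1)) (int n - 1)))
        * ((qpochs [y*q] (qpow l (2*s1)) (int n)
            * qpochs [w*q, u*q, y*w*u*t2^2*q] (qpow l (2*s2)) (int n))
          / (qpochs [w*u*t2*q] (qpow l (3*s2 - s1)) (int n)
            * qpochs [y*u*t2*q, y*w*t2*q, q/t2] (qpow l (s1 + s2)) (int n)))
      - ((qpow l (2*r2) - d*e*t1*q) * (qpow l (2*r2) - b*e*t1*q)
            * (qpow l (2*r1) - b*d*t1*q) * (qpow l (2*r1) - q/t1))
          / ((qpow l (2*r1) - b*q) * (qpow l (2*r1) - d*q)
            * (qpow l (2*r2) - e*q) * (qpow l (2*r2) - b*d*e*t1^2*q))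
      - 1/t2 *
      (\<Sum>k<n.
          one_minus_prod [y*t2 * qpow l ((s1 - s2)*real k),
                          u*t2 * qpow l ((s2 - s1)*real k),
                          w*t2 * qpow l ((s2 - s1)*real k),
                          y*w*u*t2 * qpow l ((s1 + 3*s2)*real k + 2)]
        * qpow l ((s1 + s2)*real k + 1)
        * ((qpochs [y*q] (qpow l (2*s1)) (int k)
            * qpochs [w*q, u*q, y*w*u*t2^2*q] (qpow l (2*s2)) (int k))
          / (qpochs [w*u*t2*q] (qpow l (3*s2 - s1)) (int k + 1)
            * qpochs [y*u*t2*q, y*w*t2*q, q/t2] (qpow l (s1 + s2)) (int k + 1)))
        * ((qpochs [b*q, d*q] (qpow l (2*r1)) (int k)
            * qpochs [e*q, b*d*e*t1^2*q] (qpow l (2*r2)) (int k))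
          / (qpochs [d*e*t1*q, b*e*t1*q] (qpow l (2*r2)) (int k)
            * qpochs [b*d*t1*q, q/t1] (qpow l (2*r1)) (int k))))"
proof -
  let ?Q1 = "qpow l (2*r1)" and ?Q2 = "qpow l (2*r2)"
  \<comment> \<open>Numerators and denominators are named apart because the summands mix indices:
    \<open>NA (k - 1)\<close> over \<open>DA k\<close>, and \<open>NB k\<close> over
    \<open>DB (k + 1)\<close>.\<close>
  define NA where "NA k = qpochs [b*q, d*q] ?Q1 k * qpochs [e*q, b*d*e*t1^2*q] ?Q2 k" for k
  define DA where "DA k = qpochs [d*e*t1*q, b*e*t1*q] ?Q2 k * qpochs [b*d*t1*q, q/t1] ?Q1 k" for k
  define NB where "NB k = qpochs [y*q] (qpow l (2*s1)) k
      * qpochs [w*q, u*q, y*w*u*t2^2*q] (qpow l (2*s2)) k" for k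
  define DB where "DB k = qpochs [w*u*t2*q] (qpow l (3*s2 - s1)) k
      * qpochs [y*u*t2*q, y*w*t2*q, q/t2] (qpow l (s1 + s2)) k" for k
  define A where "A k = NA k / DA k" for k
  define B where "B k = NB k / DB k" for k

  have A_diff: "A (int k) - A (int k - 1) = C0 b d t1 *
      (one_minus_prod [e*t1 * qpow l (2*(r2 - r1)*(real k - 1)),
                       b*d*e*t1 * qpow l (2*(r1 + r2)*(real k - 1) + 2)]
        * qpow l (2*r1*(real k - 1) + 1) * (NA (int k - 1) / DA (int k)))"
    if "k < n" for k
  proof -
    \<comment> \<open>Passing from index \<open>k - 1\<close> to \<open>k\<close> appends the factor
      with exponent \<open>k - 1\<close>.\<close>
    define X where "X = qpow l (2*r1*(real k - 1))"
    define Y where "Y = qpow l (2*r2*(real k - 1))"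
    have X: "X \<noteq> 0" by (simp add: X_def)
    have pows: "qpow l (2*(r2 - r1)*(real k - 1)) = Y / X"
      "qpow l (2*(r1 + r2)*(real k - 1) + 2) = X * Y * q\<^sup>2"
      "qpow l (2*r1*(real k - 1) + 1) = X * q"
      \<comment> \<open>Read backwards, the power laws merge each right side into a single power,
        with \<open>q\<close> as \<open>qpow l 1\<close>; equations between exponents
        remain.\<close>
      by (simp_all add: X_def Y_def power2_eq_square flip: qpow_add qpow_diff log_q qpow_one)
        (simp_all add: algebra_simps)
    \<comment> \<open>At \<open>k = 0\<close> this steps from index -1, so each parameter must
      differ from its base; the nonzero denominator of the boundary term says exactly this for all
      four.\<close>
    have N: "NA (int k) = NA (int k - 1)
        * ((1 - b*q*X) * (1 - d*q*X) * (1 - e*q*Y) * (1 - b*d*e*t1\<^sup>2*q*Y))"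
      using den_boundary(3) unfolding NA_def qpochs_def X_def Y_def
      by (simp add: qpoch_qpow_pred)
    have "inverse (DA (int k - 1)) =
        (1 - d*e*t1*q*Y) * (1 - b*e*t1*q*Y) * (1 - b*d*t1*q*X) * (1 - q/t1*X) / DA (int k)"
      using den_sums(1)[OF that] unfolding DA_def qpochs_def X_def Y_def
      by (simp add: inverse_qpoch_qpow_pred)
    from quotient_diff[OF N this] have "A (int k) - A (int k - 1) = NA (int k - 1) / DA (int k)
        * ((1 - b*q*X) * (1 - d*q*X) * (1 - e*q*Y) * (1 - b*d*e*t1\<^sup>2*q*Y)
         - (1 - d*e*t1*q*Y) * (1 - b*e*t1*q*Y) * (1 - b*d*t1*q*X) * (1 - q/t1*X))"
      by (simp only: A_def)
    then show ?thesis
      unfolding linear_products_diff_fst[OF nonzero(8) X] pows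
      by (simp add: one_minus_prod_def mult_ac)
  qed

  \<comment> \<open>\<open>B\<close> is stepped from \<open>k\<close> to \<open>k + 1\<close>, so
    index -1 does not arise; \<open>den_right_sum\<close> makes the common denominator
    \<open>DB (k + 1)\<close> nonzero.\<close>
  have B_diff: "B (int k + 1) - B (int k) = 1/t2 *
      (one_minus_prod [y*t2 * qpow l ((s1 - s2)*real k),
                       u*t2 * qpow l ((s2 - s1)*real k),
                       w*t2 * qpow l ((s2 - s1)*real k),
                       y*w*u*t2 * qpow l ((s1 + 3*s2)*real k + 2)]
        * qpow l ((s1 + s2)*real k + 1) * (NB (int k) / DB (int k + 1)))"
    if "k < n" for k
  proof -
    define S where "S = qpow l (s1 * real k)"
    define R where "R = qpow l (s2 * real k)"
    have S: "S \<noteq> 0" and R: "R \<noteq> 0" by (simp_all add: S_def R_def)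
    have pows: "qpow l ((s1 - s2)*real k) = S / R"
      "qpow l ((s2 - s1)*real k) = R / S"
      "qpow l ((s1 + 3*s2)*real k + 2) = S * R^3 * q\<^sup>2"
      "qpow l ((s1 + s2)*real k + 1) = S * R * q"
      "qpow l (2*s1 * real k) = S\<^sup>2" "qpow l (2*s2 * real k) = R\<^sup>2"
      "qpow l ((3*s2 - s1) * real k) = R^3 / S" "qpow l ((s1 + s2) * real k) = S * R"
      by (simp_all add: S_def R_def power2_eq_square power3_eq_cube
          flip: qpow_add qpow_diff log_q qpow_one) (simp_all add: algebra_simps)
    have N: "NB (int k + 1) = NB (int k)
        * ((1 - y*q*S\<^sup>2) * (1 - w*q*R\<^sup>2) * (1 - u*q*R\<^sup>2) * (1 - y*w*u*t2\<^sup>2*q*R\<^sup>2))"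
      unfolding NB_def qpochs_def by (simp add: qpoch_qpow_Suc pows)
    have "inverse (DB (int k)) = (1 - w*u*t2*q*(R^3/S)) * (1 - y*u*t2*q*(S*R))
        * (1 - y*w*t2*q*(S*R)) * (1 - q/t2*(S*R)) / DB (int k + 1)"
      using den_right_sum[OF that] unfolding DB_def qpochs_def
      by (simp add: inverse_qpoch_qpow_Suc pows)
    from quotient_diff[OF N this] have "B (int k + 1) - B (int k) = NB (int k) / DB (int k + 1)
        * ((1 - y*q*S\<^sup>2) * (1 - w*q*R\<^sup>2) * (1 - u*q*R\<^sup>2) * (1 - y*w*u*t2\<^sup>2*q*R\<^sup>2)
         - (1 - w*u*t2*q*(R^3/S)) * (1 - y*u*t2*q*(S*R)) * (1 - y*w*t2*q*(S*R)) * (1 - q/t2*(S*R)))"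
      by (simp only: B_def)
    then show ?thesis
      unfolding linear_products_diff_snd[OF nonzero(9) S R] pows
      by (simp add: one_minus_prod_def mult_ac)
  qed

  have B_0: "B 0 = 1"
    by (simp add: B_def NB_def DB_def qpochs_def)
  have A_init: "A (-1) = ((?Q2 - d*e*t1*q) * (?Q2 - b*e*t1*q) * (?Q1 - b*d*t1*q) * (?Q1 - q/t1))
          / ((?Q1 - b*q) * (?Q1 - d*q) * (?Q2 - e*q) * (?Q2 - b*d*e*t1^2*q))"
  proof -
    \<comment> \<open>Each \<open>(a;Q)_-1\<close> is \<open>Q / (Q - a)\<close>, which turns the
      quotient upside down; the powers of the bases cancel. With \<open>inverse\<close> the formula
      also covers \<open>a = Q\<close>, where both sides are 0.\<close>
    have eq: "qpoch a (qpow l t) (-1) = inverse ((qpow l t - a) / qpow l t)" for a t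
      by (simp add: qpoch_def diff_divide_distrib inverse_eq_divide)
    show ?thesis
      by (simp add: A_def NA_def DA_def qpochs_def eq mult.assoc)
  qed

  have "(\<Sum>k<n. (A (int k) - A (int k - 1)) * B (int k)) = C0 b d t1 *
      (\<Sum>k<n. one_minus_prod [e*t1 * qpow l (2*(r2 - r1)*(real k - 1)),
                            b*d*e*t1 * qpow l (2*(r1 + r2)*(real k - 1) + 2)]
        * qpow l (2*r1*(real k - 1) + 1) * (NA (int k - 1) / DA (int k)) * B (int k))"
    by (simp add: A_diff sum_distrib_left mult.assoc)
  moreover have "(\<Sum>k<n. (B (int k + 1) - B (int k)) * A (int k)) = 1/t2 *
      (\<Sum>k<n. one_minus_prod [y*t2 * qpow l ((s1 - s2)*real k),
                            u*t2 * qpow l ((s2 - s1)*real k),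
                            w*t2 * qpow l ((s2 - s1)*real k),
                            y*w*u*t2 * qpow l ((s1 + 3*s2)*real k + 2)]
        * qpow l ((s1 + s2)*real k + 1) * (NB (int k) / DB (int k + 1)) * A (int k))"
    unfolding sum_distrib_left by (rule sum.cong) (simp_all only: B_diff lessThan_iff mult.assoc)
  ultimately show ?thesis
    using sum_by_parts[of A B n]
    \<comment> \<open>The boundary values are substituted while \<open>A\<close> and
      \<open>B\<close> are still folded, since unfolding would destroy the term
      \<open>A (-1)\<close>.\<close>
    unfolding A_init B_0 mult_1_right by (simp only: A_def B_def NA_def DA_def NB_def DB_def)
qed

end
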